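(* There is an absolute constant $C$ such that for all integers $m$ and all integers $n>\sqrt{|m|}$ (with $n\ge3$, so that the expression is defined), $$N_{\mathrm{root}}(4m;-n)\le C\, n(\log n)(\log\log n)^2 .$$ That is, $N_{\mathrm{root}}(4m;-n)=O(n\log n(\log\log n)^2)$ uniformly for $n>\sqrt{|m|}$, with implied constant independent of $m$.
   Context: $Q_{\mathcal D}(a,b,c,d)=2(a^2+b^2+c^2+d^2)-(a+b+c+d)^2$. For a quadruple $\mathbf v$, $|\mathbf v|$ is the sum of absolute values of its coordinates. $\mathbf S_i$ ($i=1,\dots,4$) is the integer matrix replacing the $i$-th coordinate $a_i$ of a quadruple by $2\sum_{j\ne i}a_j-a_i$, other coordinates fixed. An integer quadruple is reduced if no $\mathbf S_i$ strictly decreases $|\cdot|$; a reduced quadruple ordered as $a\le b\le c\le d$ with $a+b+c+d\ge0$ is a root quadruple if $a+b+c\ge d>0$. $N_{\mathrm{root}}(4m;-n)$ is the number of ordered integer root quadruples $(a,b,c,d)$, $a\le b\le c\le d$, with $a+b+c+d>0$, $Q_{\mathcal D}(a,b,c,d)=4m$ and $a=-n$. *)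

theory Defs
  imports Complex_Main
begin

text \<open>Quadruples are integer lists of length 4; coordinate i (1..4 in the paper) is index i-1.\<close>

definition QD :: "int list \<Rightarrow> int" where
  "QD v = 2 * (\<Sum>x\<leftarrow>v. x^2) - (sum_list v)^2"

definition qnorm :: "int list \<Rightarrow> int" where
  "qnorm v = (\<Sum>x\<leftarrow>v. \<bar>x\<bar>)"

definition Smap :: "nat \<Rightarrow> int list \<Rightarrow> int list" where
  "Smap i v = v[i := 2 * (sum_list v - v ! i) - v ! i]"

definition reduced :: "int list \<Rightarrow> bool" where
  "reduced v \<longleftrightarrow> (\<forall>i<4. \<not> qnorm (Smap i v) < qnorm v)"

definition root_quadruple :: "int \<Rightarrow> int \<Rightarrow> int \<Rightarrow> int \<Rightarrow> bool" where
  "root_quadruple a b c d \<longleftrightarrow>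
     reduced [a, b, c, d] \<and> a \<le> b \<and> b \<le> c \<and> c \<le> d \<and> a + b + c + d \<ge> 0
     \<and> a + b + c \<ge> d \<and> d > 0"

definition N_root :: "int \<Rightarrow> int \<Rightarrow> nat" where
  "N_root m n = card {(a, b, c, d). root_quadruple a b c d \<and> a + b + c + d > 0
                     \<and> QD [a, b, c, d] = 4 * m \<and> a = - n}"

end

theory Submission
  imports Defs "HOL-Computational_Algebra.Primes"
begin

text \<open>
  Writing a root quadruple as (-n, n + A, n + C, n + A + C - 2B) turns the equation into
  AC - B^2 = D with D = n^2 - m, and the root conditions into 0 \<le> 2B \<le> A \<le> C. Hence
  0 < A < 2n, and one counts pairs (A, B) with A dividing B^2 + D.

  For each A fix one square root B' of -D modulo A. Any other root B splits A as UV with U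
  dividing B - B' and V dividing B + B'. If h = gcd(U, V), then (U, V) determines B modulo A / h,
  hence up to h choices, and h^2 divides 4D. Summing h over all pairs (hu, hv) with
  h^2 u v \<le> 2n gives at most 2n (1 + log 2n) times the sum of 1/h over the divisors h of 4D.

  The sum of inverse divisors of M is at most the product of p / (p - 1) over the primes p
  dividing M. The at most log M primes above log M contribute a bounded factor. For the others,
  the central binomial coefficient shows that the primes in (2^k, 2^(k+1)] have sum of
  1 / (p - 1) at most 2 / k, so the product is of order (log log M)^2.
\<close>

section \<open>Harmonic sums and sums of inverse divisors\<close>

lemma harmonic_sum_le: "(\<Sum>k=1..n. 1 / real k) \<le> 1 + ln (real n)" if "n \<ge> 1"
  using that
proof (induction n rule: nat_induct_at_least)
  case base
  then show ?case by simp
next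
  case (Suc n)
  have "ln (real n / real (Suc n)) \<le> real n / real (Suc n) - 1"
    using Suc by (intro ln_le_minus_one) auto
  also have "real n / real (Suc n) - 1 = - 1 / real (Suc n)"
    by (simp add: field_simps)
  finally have "1 / real (Suc n) \<le> ln (real (Suc n)) - ln (real n)"
    using Suc by (simp add: ln_div)
  with Suc.IH show ?case by simp
qed

text \<open>Induction on \<open>P\<close>, splitting off the full power of one prime: a divisor of
  \<open>p ^ k * M'\<close> is \<open>p ^ i * d\<close> with \<open>i \<le> k\<close> and
  \<open>d\<close> dividing \<open>M'\<close>, so the sum picks up at most a geometric series in
  \<open>1 / p\<close>. Letting \<open>P\<close> be a superset of the prime factors covers
  \<open>k = 0\<close> without a case split.\<close>

lemma sum_inverse_divisors_le_prod:
  fixes P :: "nat set"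
  assumes "finite P" "\<And>p. p \<in> P \<Longrightarrow> prime p" "M > 0" "prime_factors M \<subseteq> P"
  shows "(\<Sum>d | d dvd M. 1 / real d) \<le> (\<Prod>p\<in>P. real p / (real p - 1))"
  using assms
proof (induction P arbitrary: M rule: finite_induct)
  case empty
  then have "prime_factors M = {}" by simp
  then have "M = 1" using \<open>M > 0\<close> by (simp add: prime_factorization_empty_iff)
  then show ?case by simp
next
  case (insert p P)
  have p: "prime p" using insert.prems by simp
  then have p2: "real p \<ge> 2" using prime_ge_2_nat[of p] by simp
  obtain M' where M': "M = p ^ multiplicity p M * M'" "\<not> p dvd M'"
    using multiplicity_decompose'[of M p] \<open>M > 0\<close> p by (metis less_irrefl not_prime_unit)
  define k where "k = multiplicity p M"
  have Mk: "M = p ^ k * M'" using M' by (simp add: k_def)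
  have "M' > 0" using Mk \<open>M > 0\<close> by (cases M') auto
  have "prime_factors M' \<subseteq> P"
  proof
    fix q assume q: "q \<in> prime_factors M'"
    then have "q \<in> prime_factors M" using Mk \<open>M > 0\<close>
      by (auto simp: prime_factors_dvd)
    moreover have "q \<noteq> p" using q M' by auto
    ultimately show "q \<in> P" using insert.prems by auto
  qed
  then have IH: "(\<Sum>d | d dvd M'. 1 / real d) \<le> (\<Prod>p\<in>P. real p / (real p - 1))"
    using insert.IH \<open>M' > 0\<close> insert.prems by auto
  have geo: "(\<Sum>i\<le>k. 1 / real p ^ i) \<le> real p / (real p - 1)"
  proof -
    have "(\<Sum>i\<le>k. 1 / real p ^ i) = (\<Sum>i<Suc k. (1 / real p) ^ i)"
      by (simp add: power_one_over lessThan_Suc_atMost)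
    also have "\<dots> \<le> (\<Sum>i. (1 / real p) ^ i)"
      using p2 by (intro sum_le_suminf summable_geometric) auto
    also have "\<dots> = real p / (real p - 1)"
      using p2 by (subst suminf_geometric) (auto simp: field_simps)
    finally show ?thesis .
  qed
  have fin: "finite {d. d dvd M'}" using \<open>M' > 0\<close> by (rule finite_divisors_nat)
  \<comment> \<open>An inclusion is enough here: the terms are nonnegative and only an upper bound
    is wanted.\<close>
  have "{d. d dvd M} \<subseteq> (\<lambda>(i, d). p ^ i * d) ` ({..k} \<times> {d. d dvd M'})"
  proof
    fix d assume "d \<in> {d. d dvd M}"
    then obtain b c where bc: "d = b * c" "b dvd p ^ k" "c dvd M'"
      using division_decomp[of d "p ^ k" M'] Mk by auto
    then obtain i where "i \<le> k" "b = p ^ i" using divides_primepow_nat[OF p] by auto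
    with bc show "d \<in> (\<lambda>(i, d). p ^ i * d) ` ({..k} \<times> {d. d dvd M'})" by force
  qed
  then have "(\<Sum>d | d dvd M. 1 / real d)
      \<le> (\<Sum>d \<in> (\<lambda>(i, d). p ^ i * d) ` ({..k} \<times> {d. d dvd M'}). 1 / real d)"
    using fin by (intro sum_mono2) auto
  also have "\<dots> \<le> (\<Sum>x \<in> {..k} \<times> {d. d dvd M'}. 1 / real ((\<lambda>(i, d). p ^ i * d) x))"
    using sum_image_le[of "{..k} \<times> {d. d dvd M'}" "\<lambda>d. 1 / real d" "\<lambda>(i, d). p ^ i * d"] fin
    by (simp add: o_def)
  also have "\<dots> = (\<Sum>i\<le>k. 1 / real p ^ i) * (\<Sum>d | d dvd M'. 1 / real d)"
    by (simp add: sum_product sum.cartesian_product case_prod_unfold)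
  also have "\<dots> \<le> real p / (real p - 1) * (\<Prod>p\<in>P. real p / (real p - 1))"
    using geo IH p2 by (intro mult_mono sum_nonneg) auto
  finally show ?case using insert.hyps by simp
qed

section \<open>Chebyshev-type bounds on primes and their effect on divisor sums\<close>

lemma prod_primes_dvd:
  fixes x :: nat
  assumes "finite P" "\<And>p. p \<in> P \<Longrightarrow> prime p \<and> p dvd x"
  shows "\<Prod>P dvd x"
  using assms
proof (induction P rule: finite_induct)
  case (insert p P)
  have "coprime p (\<Prod>P)"
    using insert by (intro prod_coprime_right primes_coprime) auto
  then show ?case using insert by (auto intro: divides_mult)
qed auto

text \<open>With \<open>N = 2 ^ k\<close>, a prime in (N, 2N] divides \<open>fact (2 * N)\<close>
  but not \<open>fact N\<close>, hence it divides the central binomial coefficient. The product of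
  these primes is therefore at most \<open>2 ^ (2 * N)\<close>, while each of them exceeds
  \<open>2 ^ k\<close>; comparing exponents gives the bound.\<close>

lemma card_primes_mult_dyadic_le:
  "k * card {p::nat. prime p \<and> 2 ^ k < p \<and> p \<le> 2 ^ Suc k} \<le> 2 ^ Suc k"
proof -
  define N :: nat where "N = 2 ^ k"
  define P where "P = {p::nat. prime p \<and> N < p \<and> p \<le> 2 * N}"
  have finP: "finite P" by (rule finite_subset[of _ "{..2 * N}"]) (auto simp: P_def)
  have dvd: "p dvd (2 * N choose N)" if "p \<in> P" for p
  proof -
    have p: "prime p" "N < p" "p \<le> 2 * N" using that by (auto simp: P_def)
    have "fact N * fact N * (2 * N choose N) = (fact (2 * N) :: nat)"
      using binomial_fact_lemma[of N "2 * N"] by simp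
    moreover have "p dvd fact (2 * N)" using p by (simp add: prime_dvd_fact_iff)
    moreover have "\<not> p dvd fact N" using p by (simp add: prime_dvd_fact_iff)
    ultimately show ?thesis using p by (metis prime_dvd_mult_iff)
  qed
  have "(2 ^ k) ^ card P = (\<Prod>p\<in>P. N)" by (simp add: N_def)
  also have "\<dots> \<le> \<Prod>P" by (intro prod_mono) (auto simp: P_def)
  also have "\<dots> \<le> (2 * N choose N)"
    using finP dvd by (intro dvd_imp_le prod_primes_dvd) (auto simp: P_def)
  also have "\<dots> \<le> 2 ^ (2 * N)" by (rule binomial_le_pow2)
  finally have "(2::nat) ^ (k * card P) \<le> 2 ^ (2 * N)" by (simp add: power_mult)
  then have "k * card P \<le> 2 * N" by (simp only: power_increasing_iff)
  then show ?thesis by (simp add: P_def N_def)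
qed

text \<open>Dyadic blocks: at most \<open>2 ^ Suc k / k\<close> primes lie in (2^k, 2^(k+1)], each
  contributing at most \<open>1 / 2 ^ k\<close>, so a block adds at most \<open>2 / k\<close>.
  Summing over \<open>k\<close> leaves a harmonic sum. This is a Mertens-type upper bound with
  constant 2 in place of 1.\<close>

lemma sum_inverse_primes_le:
  assumes "K \<ge> 1"
  shows "(\<Sum>p | prime p \<and> p \<le> (2::nat) ^ K. 1 / (real p - 1)) \<le> 3 + 2 * ln (real K)"
proof -
  have step: "(\<Sum>p | prime p \<and> p \<le> (2::nat) ^ K. 1 / (real p - 1)) \<le> 1 + 2 * (\<Sum>k=1..<K. 1 / real k)"
    using assms
  proof (induction K rule: nat_induct_at_least)
    case base
    have "{p::nat. prime p \<and> p \<le> 2} = {2}" by (auto dest: prime_ge_2_nat)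
    then show ?case by simp
  next
    case (Suc k)
    let ?P = "{p::nat. prime p \<and> 2 ^ k < p \<and> p \<le> 2 ^ Suc k}"
    let ?Q = "{p::nat. prime p \<and> p \<le> 2 ^ k}"
    have fin: "finite ?P" "finite ?Q"
      by (rule finite_subset[of _ "{..2 ^ Suc k}"]; auto)
         (rule finite_subset[of _ "{..2 ^ k}"]; auto)
    have split: "{p::nat. prime p \<and> p \<le> 2 ^ Suc k} = ?Q \<union> ?P" by auto
    have "(\<Sum>p\<in>?P. 1 / (real p - 1)) \<le> (\<Sum>p\<in>?P. 1 / 2 ^ k)"
    proof (intro sum_mono frac_le)
      fix p assume "p \<in> ?P"
      then have "2 ^ k + 1 \<le> p" by auto
      then have "real (2 ^ k + 1) \<le> real p" by (simp only: of_nat_le_iff)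
      then show "2 ^ k \<le> real p - 1" by simp
    qed auto
    also have "\<dots> = real (card ?P) / 2 ^ k" by simp
    also have "\<dots> \<le> 2 / real k"
    proof -
      have "real (k * card ?P) \<le> real (2 ^ Suc k)"
        using card_primes_mult_dyadic_le[of k] by (simp only: of_nat_le_iff)
      then show ?thesis using Suc.hyps by (simp add: field_simps)
    qed
    finally have "(\<Sum>p\<in>?P. 1 / (real p - 1)) \<le> 2 / real k" .
    moreover have "(\<Sum>p\<in>?Q \<union> ?P. 1 / (real p - 1))
        = (\<Sum>p\<in>?Q. 1 / (real p - 1)) + (\<Sum>p\<in>?P. 1 / (real p - 1))"
      using fin by (intro sum.union_disjoint) auto
    ultimately show ?case using Suc unfolding split by simp
  qed
  have "(\<Sum>k=1..<K. 1 / real k) \<le> (\<Sum>k=1..K. 1 / real k)"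
    by (intro sum_mono2) auto
  also have "\<dots> \<le> 1 + ln (real K)" by (rule harmonic_sum_le[OF assms])
  finally show ?thesis using step by simp
qed

text \<open>\<open>L\<close> bounds the number of prime factors of \<open>M\<close>, because the
  product of the distinct ones is at least 2 to their number. The Euler product is turned into the
  exponential of the sum of \<open>1 / (p - 1)\<close> and split at \<open>2 ^ K\<close>. The
  exponent 4 is 3 from the small primes plus 1 from the large ones; the square comes from
  \<open>2 * ln K\<close>.\<close>

lemma sum_inverse_divisors_le:
  fixes M K L :: nat
  assumes "M > 0" "M < 2 ^ L" "L \<le> 2 ^ K" "K \<ge> 1"
  shows "(\<Sum>d | d dvd M. 1 / real d) \<le> exp 4 * real K ^ 2"
proof -
  let ?P = "prime_factors M"
  have ge2: "real p \<ge> 2" if "p \<in> ?P" for p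
    using that prime_ge_2_nat[of p] by auto
  have "(2::nat) ^ card ?P = (\<Prod>p\<in>?P. 2)" by simp
  also have "\<dots> \<le> \<Prod>?P" by (intro prod_mono) (auto intro: prime_ge_2_nat)
  also have "\<dots> \<le> M" using assms by (intro dvd_imp_le prod_primes_dvd) auto
  also have "\<dots> < 2 ^ L" by fact
  finally have cardP: "card ?P \<le> L" by simp
  have "L > 0" using assms by (cases L) auto
  let ?S = "{p \<in> ?P. p \<le> 2 ^ K}" and ?B = "{p \<in> ?P. 2 ^ K < p}"
  have "(\<Sum>p\<in>?S. 1 / (real p - 1)) \<le> (\<Sum>p | prime p \<and> p \<le> (2::nat) ^ K. 1 / (real p - 1))"
  proof (intro sum_mono2)
    show "finite {p::nat. prime p \<and> p \<le> 2 ^ K}"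
      by (rule finite_subset[of _ "{..2 ^ K}"]) auto
  qed (auto dest: prime_ge_1_nat)
  also have "\<dots> \<le> 3 + 2 * ln (real K)" by (rule sum_inverse_primes_le[OF assms(4)])
  finally have S: "(\<Sum>p\<in>?S. 1 / (real p - 1)) \<le> 3 + 2 * ln (real K)" .
  \<comment> \<open>Large primes exceed \<open>2 ^ K\<close>, hence also \<open>L\<close>, and there
    are at most \<open>L\<close> of them, so together they contribute at most 1.\<close>
  have "(\<Sum>p\<in>?B. 1 / (real p - 1)) \<le> (\<Sum>p\<in>?B. 1 / real L)"
  proof (intro sum_mono frac_le)
    fix p assume "p \<in> ?B"
    then have "L + 1 \<le> p" using assms by auto
    then show "real L \<le> real p - 1" by linarith
  qed (use \<open>L > 0\<close> in auto)
  also have "\<dots> = real (card ?B) / real L" by simp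
  also have "\<dots> \<le> 1"
  proof -
    have "card ?B \<le> card ?P" by (intro card_mono) auto
    then show ?thesis using cardP \<open>L > 0\<close> by simp
  qed
  finally have B: "(\<Sum>p\<in>?B. 1 / (real p - 1)) \<le> 1" .
  have "?P = ?S \<union> ?B" by auto
  then have "(\<Sum>p\<in>?P. 1 / (real p - 1)) = (\<Sum>p\<in>?S \<union> ?B. 1 / (real p - 1))" by simp
  also have "\<dots> = (\<Sum>p\<in>?S. 1 / (real p - 1)) + (\<Sum>p\<in>?B. 1 / (real p - 1))"
    by (intro sum.union_disjoint) auto
  finally have sumP: "(\<Sum>p\<in>?P. 1 / (real p - 1)) \<le> 4 + 2 * ln (real K)"
    using S B by linarith
  have "(\<Sum>d | d dvd M. 1 / real d) \<le> (\<Prod>p\<in>?P. real p / (real p - 1))"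
    using assms by (intro sum_inverse_divisors_le_prod) auto
  also have "\<dots> \<le> (\<Prod>p\<in>?P. exp (1 / (real p - 1)))"
  proof (intro prod_mono conjI)
    fix p assume "p \<in> ?P"
    note p = ge2[OF this]
    show "0 \<le> real p / (real p - 1)" using p by simp
    have "real p / (real p - 1) = 1 + 1 / (real p - 1)" using p by (simp add: field_simps)
    also have "\<dots> \<le> exp (1 / (real p - 1))" by (rule exp_ge_add_one_self)
    finally show "real p / (real p - 1) \<le> exp (1 / (real p - 1))" .
  qed
  also have "\<dots> = exp (\<Sum>p\<in>?P. 1 / (real p - 1))" by (simp add: exp_sum)
  also have "\<dots> \<le> exp (4 + 2 * ln (real K))" using sumP by simp
  also have "\<dots> = exp 4 * exp (ln (real K)) ^ 2" by (simp only: exp_add exp_double)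
  also have "exp (ln (real K)) = real K" using assms by simp
  finally show ?thesis .
qed

section \<open>Counting square roots of -D to varying moduli\<close>

text \<open>All elements share one remainder modulo \<open>q\<close>, so each is determined by its
  quotient, which lies in \<open>{0..<h}\<close>.\<close>

lemma card_pairwise_cong_le:
  fixes X :: "int set" and q :: int and h :: nat
  assumes "X \<subseteq> {0..<int h * q}" "q > 0" "\<And>x y. x \<in> X \<Longrightarrow> y \<in> X \<Longrightarrow> q dvd x - y"
  shows "card X \<le> h"
proof -
  have "inj_on (\<lambda>x. x div q) X"
  proof (rule inj_onI)
    fix x y assume xy: "x \<in> X" "y \<in> X" "x div q = y div q"
    have "x mod q = y mod q" using assms(3)[OF xy(1,2)] by (simp add: mod_eq_dvd_iff)
    then show "x = y" using xy(3) by (metis div_mult_mod_eq)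
  qed
  moreover have "(\<lambda>x. x div q) ` X \<subseteq> {0..<int h}"
  proof (rule image_subsetI)
    fix x assume "x \<in> X"
    then have x: "0 \<le> x" "x < int h * q" using assms(1) by auto
    have "x div q * q \<le> x" using assms(2) by (simp add: minus_mod_eq_div_mult [symmetric])
    then have "x div q * q < int h * q" using x by linarith
    then have "x div q < int h" using assms(2) by simp
    then show "x div q \<in> {0..<int h}" using assms(2) x by (simp add: pos_imp_zdiv_nonneg_iff)
  qed
  ultimately have "card X \<le> card {0..<int h}" by (intro card_inj_on_le) auto
  then show ?thesis by simp
qed

text \<open>\<open>A\<close> divides \<open>(B - B') * (B + B')\<close>. Taking
  \<open>U = gcd A (B - B')\<close> puts the complementary factor \<open>V = A div U\<close> into
  \<open>B + B'\<close>; then \<open>h = gcd U V\<close>, and \<open>u\<close>, \<open>v\<close> are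
  the coprime cofactors.\<close>

lemma split_modulus_of_sqrt_pair:
  fixes A B B' D :: int
  assumes "A > 0" "D > 0" "A dvd B\<^sup>2 + D" "A dvd B'\<^sup>2 + D"
  obtains h u v :: nat where
    "h dvd nat (4 * D)" "h > 0" "u > 0" "v > 0" "coprime u v" "A = int (h * h * u * v)"
    "int (h * u) dvd B - B'" "int (h * v) dvd B + B'"
proof -
  define U where "U = gcd A (B - B')"
  define V where "V = A div U"
  have "U > 0" using assms(1) by (simp add: U_def)
  have AUV: "A = U * V" by (simp add: V_def U_def)
  have "V > 0" using AUV \<open>U > 0\<close> assms(1) by (simp add: zero_less_mult_iff)
  have VB: "V dvd B + B'"
  proof -
    obtain w where w: "B - B' = U * w" unfolding U_def by (meson dvdE gcd_dvd2)
    \<comment> \<open>Since \<open>U\<close> is already the whole gcd, nothing of \<open>V\<close>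
      is left in \<open>w\<close>, so \<open>V\<close> must divide the other factor
      \<open>B + B'\<close>.\<close>
    have "gcd A (B - B') = U * gcd V w"
      unfolding AUV w using \<open>U > 0\<close> gcd_mult_distrib_int[of U V w] by simp
    then have "coprime V w" using \<open>U > 0\<close> by (simp add: U_def [symmetric] coprime_iff_gcd_eq_1)
    have "A dvd (B\<^sup>2 + D) - (B'\<^sup>2 + D)" using assms by (intro dvd_diff)
    also have "(B\<^sup>2 + D) - (B'\<^sup>2 + D) = (B - B') * (B + B')"
      by (simp add: power2_eq_square algebra_simps)
    finally have "V dvd w * (B + B')" using AUV w \<open>U > 0\<close> by (simp add: mult.assoc)
    with \<open>coprime V w\<close> show ?thesis by (simp add: coprime_dvd_mult_right_iff)
  qed
  define h where "h = gcd U V"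
  have "h > 0" using \<open>U > 0\<close> by (simp add: h_def)
  obtain u v where uv: "U = h * u" "V = h * v" "coprime u v"
    using gcd_coprime_exists[of U V] \<open>h > 0\<close> unfolding h_def by (metis less_irrefl mult.commute)
  have pos: "u > 0" "v > 0" using uv \<open>h > 0\<close> \<open>U > 0\<close> \<open>V > 0\<close> by (simp_all add: zero_less_mult_iff)
  have UB: "U dvd B - B'" by (simp add: U_def)
  \<comment> \<open>\<open>h ^ 2\<close> divides both \<open>(2 * B') ^ 2\<close> and, through
    \<open>A\<close>, \<open>4 * (B'^2 + D)\<close>. Eliminating \<open>B'\<close> leaves a
    condition on \<open>D\<close> alone.\<close>
  have "h dvd B - B'" "h dvd B + B'" using UB VB uv by (auto elim: dvd_mult_left)
  then have "h dvd (B + B') - (B - B')" using dvd_diff by blast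
  then have "h dvd 2 * B'" by simp
  then have "h ^ 2 dvd (2 * B') ^ 2" by (rule dvd_power_same)
  moreover have "h ^ 2 dvd 4 * (B'\<^sup>2 + D)"
  proof -
    have "h ^ 2 dvd A" using AUV uv by (simp add: power2_eq_square)
    then show ?thesis using assms(4) by (meson dvd_mult dvd_trans)
  qed
  ultimately have "h ^ 2 dvd 4 * (B'\<^sup>2 + D) - (2 * B') ^ 2" by (intro dvd_diff)
  also have "4 * (B'\<^sup>2 + D) - (2 * B') ^ 2 = 4 * D" by (simp add: power2_eq_square algebra_simps)
  finally have "h dvd 4 * D" by (metis dvd_mult_left power2_eq_square)
  show thesis
  proof (rule that[of "nat h" "nat u" "nat v"])
    show "nat h dvd nat (4 * D)" using \<open>h dvd 4 * D\<close> \<open>h > 0\<close> \<open>D > 0\<close> by (simp add: nat_dvd_iff)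
    show "coprime (nat u) (nat v)"
      using uv(3) pos by (simp flip: coprime_int_iff)
    show "A = int (nat h * nat h * nat u * nat v)"
      using AUV uv pos \<open>h > 0\<close> by (simp add: mult_ac)
    show "int (nat h * nat u) dvd B - B'" using UB uv pos \<open>h > 0\<close> by simp
    show "int (nat h * nat v) dvd B + B'" using VB uv pos \<open>h > 0\<close> by simp
  qed (use pos \<open>h > 0\<close> in auto)
qed

text \<open>A triple (h, u, v) fixes \<open>A\<close> and leaves at most \<open>h\<close> choices
  for \<open>B\<close>. For given \<open>h\<close> and \<open>u\<close> there are at most
  \<open>X / (h * h * u)\<close> values of \<open>v\<close>, so the total weight is at most
  \<open>X / (u * h)\<close>, and the double sum factors.\<close>

lemma card_sqrt_residues_le:
  fixes D :: int and X :: nat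
  assumes "D > 0"
  shows "real (card {(A, B). 0 < A \<and> A \<le> int X \<and> 0 \<le> B \<and> B < A \<and> A dvd B\<^sup>2 + D})
    \<le> real X * (\<Sum>u=1..X. 1 / real u) * (\<Sum>h | h dvd nat (4 * D). 1 / real h)"
proof -
  define S where "S = {(A, B). 0 < A \<and> A \<le> int X \<and> 0 \<le> B \<and> B < A \<and> A dvd B\<^sup>2 + D}"
  \<comment> \<open>A reference root depending on \<open>A\<close> only. It is a genuine root
    whenever some pair of \<open>S\<close> has first component \<open>A\<close>.\<close>
  define R where "R A = (SOME B. A dvd B\<^sup>2 + D)" for A
  have R: "A dvd (R A)\<^sup>2 + D" if "(A, B) \<in> S" for A B
    using that unfolding R_def S_def by (auto intro: someI)
  define T where "T = (\<lambda>(h, u, v). {(A, B). (A, B) \<in> S \<and> A = int (h * h * u * v) \<and> coprime u v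
      \<and> int (h * u) dvd B - R A \<and> int (h * v) dvd B + R A})"
  define H where "H = {h. h dvd nat (4 * D)}"
  have finH: "finite H" using assms by (simp add: H_def)
  have Hpos: "h > 0" if "h \<in> H" for h
    using that assms by (auto simp: H_def intro: Nat.gr0I)
  \<comment> \<open>The range of \<open>v\<close> encodes \<open>h * h * u * v = A \<le> X\<close>.
    The sets \<open>T i\<close> may overlap, as only a cover of \<open>S\<close> is needed.\<close>
  define I where "I = (SIGMA h:H. SIGMA u:{1..X}. {1..X div (h * h * u)})"
  have finI: "finite I" using finH by (auto simp: I_def)
  have finS: "finite S"
    by (rule finite_subset[of _ "{0..int X} \<times> {0..int X}"]) (auto simp: S_def)
  have cover: "S \<subseteq> (\<Union>i\<in>I. T i)"
  proof
    fix x assume "x \<in> S"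
    then obtain A B where x: "x = (A, B)" and AB: "(A, B) \<in> S" by (cases x) auto
    then have AB': "0 < A" "A \<le> int X" "A dvd B\<^sup>2 + D" by (auto simp: S_def)
    obtain h u v where huv: "h dvd nat (4 * D)" "h > 0" "u > 0" "v > 0" "coprime u v"
      "A = int (h * h * u * v)" "int (h * u) dvd B - R A" "int (h * v) dvd B + R A"
      using split_modulus_of_sqrt_pair[OF AB'(1) assms AB'(3) R[OF AB]] by metis
    have le: "h * h * u * v \<le> X" using huv(6) AB'(2) by (simp only: of_nat_le_iff)
    then have "v \<le> X div (h * h * u)"
      using huv by (simp add: less_eq_div_iff_mult_less_eq mult_ac)
    moreover have "u \<le> X" using dvd_imp_le[of u "h * h * u * v"] huv le
      by (metis dvd_triv_left dvd_mult2 dvd_triv_right le_trans mult_pos_pos)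
    ultimately have "(h, u, v) \<in> I" using huv by (auto simp: I_def H_def)
    moreover have "x \<in> T (h, u, v)" using huv AB x by (simp add: T_def)
    ultimately show "x \<in> (\<Union>i\<in>I. T i)" by blast
  qed
  have cardT: "card (T (h, u, v)) \<le> h" if "(h, u, v) \<in> I" for h u v
  proof -
    have pos: "h > 0" "u > 0" "v > 0" using that Hpos by (auto simp: I_def)
    let ?A = "int (h * h * u * v)"
    have inj: "inj_on snd (T (h, u, v))" by (auto simp: T_def inj_on_def)
    have "card (snd ` T (h, u, v)) \<le> h"
    \<comment> \<open>The modulus is \<open>A / h\<close>, while \<open>B\<close> ranges over an
      interval of length \<open>A\<close>.\<close>
    proof (rule card_pairwise_cong_le[where q = "int (h * u * v)"])
      show "snd ` T (h, u, v) \<subseteq> {0..<int h * int (h * u * v)}"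
        by (auto simp: T_def S_def mult_ac)
      show "int (h * u * v) > 0" using pos by simp
      fix x y assume "x \<in> snd ` T (h, u, v)" "y \<in> snd ` T (h, u, v)"
      then have xy: "coprime u v" "int (h * u) dvd x - R ?A" "int (h * v) dvd x + R ?A"
        "int (h * u) dvd y - R ?A" "int (h * v) dvd y + R ?A"
        by (auto simp: T_def)
      have "int (h * u) dvd (x - R ?A) - (y - R ?A)" using xy(2,4) by (rule dvd_diff)
      then have u: "int h * int u dvd x - y" by simp
      have "int (h * v) dvd (x + R ?A) - (y + R ?A)" using xy(3,5) by (rule dvd_diff)
      then have v: "int h * int v dvd x - y" by simp
      \<comment> \<open>After cancelling the common factor \<open>h\<close>, coprimality of
        \<open>u\<close> and \<open>v\<close> combines the two congruences.\<close>
      obtain w where w: "x - y = int h * w" using u by (metis dvd_def dvd_mult_left)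
      have "int u dvd w" "int v dvd w" using u v w pos by simp_all
      then have "int u * int v dvd w" using xy(1) by (intro divides_mult) auto
      then show "int (h * u * v) dvd x - y" using w by (simp add: mult.assoc)
    qed
    then show ?thesis using inj by (simp add: card_image)
  qed
  have "card S \<le> card (\<Union>i\<in>I. T i)"
  proof (rule card_mono[OF _ cover])
    have "(\<Union>i\<in>I. T i) \<subseteq> S" by (auto simp: T_def)
    then show "finite (\<Union>i\<in>I. T i)" using finS by (rule finite_subset)
  qed
  also have "\<dots> \<le> (\<Sum>i\<in>I. card (T i))" by (rule card_UN_le[OF finI])
  also have "\<dots> \<le> (\<Sum>(h, u, v)\<in>I. h)" using cardT by (intro sum_mono) auto
  also have "\<dots> = (\<Sum>h\<in>H. \<Sum>u=1..X. \<Sum>v=1..X div (h * h * u). h)"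
  proof -
    have inner: "(\<Sum>u=1..X. \<Sum>v=1..X div (h * h * u). h)
        = (\<Sum>(u, v)\<in>(SIGMA u:{1..X}. {1..X div (h * h * u)}). h)" for h
      by (rule sum.Sigma) auto
    show ?thesis unfolding I_def inner by (rule sum.Sigma [symmetric]) (use finH in auto)
  qed
  also have "\<dots> = (\<Sum>h\<in>H. \<Sum>u=1..X. X div (h * h * u) * h)" by simp
  finally have "real (card S) \<le> (\<Sum>h\<in>H. \<Sum>u=1..X. real (X div (h * h * u) * h))"
    by (simp only: of_nat_le_iff flip: of_nat_sum)
  also have "\<dots> \<le> (\<Sum>h\<in>H. \<Sum>u=1..X. real X * (1 / real u) * (1 / real h))"
  proof (intro sum_mono)
    fix h u assume "h \<in> H" "u \<in> {1..X}"
    then have pos: "h > 0" "u > 0" using Hpos by auto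
    have "real (X div (h * h * u) * h) \<le> real X / real (h * h * u) * real h"
      unfolding of_nat_mult[of "X div (h * h * u)" h]
      by (intro mult_right_mono of_nat_div_le_of_nat) simp
    also have "\<dots> = real X * (1 / real u) * (1 / real h)" using pos by (simp add: field_simps)
    finally show "real (X div (h * h * u) * h) \<le> real X * (1 / real u) * (1 / real h)" .
  qed
  also have "\<dots> = real X * (\<Sum>u=1..X. 1 / real u) * (\<Sum>h\<in>H. 1 / real h)"
    by (simp only: sum_distrib_left sum_distrib_right)
  finally show ?thesis by (simp only: S_def H_def)
qed

section \<open>From root quadruples to pairs (A, B)\<close>

text \<open>In the coordinates A, B, C the equation reads \<open>A * C = B^2 + (n^2 - m)\<close>. As
  \<open>A > 0\<close>, the pair (A, B) determines \<open>C\<close> and with it the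
  quadruple.\<close>

lemma N_root_le_card_sqrt_residues:
  fixes m n :: int
  assumes "n > 0" "\<bar>m\<bar> < n\<^sup>2"
  shows "N_root m n \<le> card {(A, B). 0 < A \<and> A \<le> 2 * n \<and> 0 \<le> B \<and> B < A \<and> A dvd B\<^sup>2 + (n\<^sup>2 - m)}"
    (is "_ \<le> card ?S")
proof -
  define Q where "Q = {(a, b, c, d). root_quadruple a b c d \<and> a + b + c + d > 0
                     \<and> QD [a, b, c, d] = 4 * m \<and> a = - n}"
  define f :: "int \<times> int \<times> int \<times> int \<Rightarrow> int \<times> int" where
    "f = (\<lambda>(a, b, c, d). (b - n, (a + b + c - d) div 2))"
  have Q: "\<exists>A B C. x = (- n, n + A, n + C, n + A + C - 2 * B) \<and> f x = (A, B)
      \<and> A * C = B\<^sup>2 + (n\<^sup>2 - m) \<and> 0 < A \<and> A \<le> C \<and> 0 \<le> B \<and> 2 * B \<le> A" if xQ: "x \<in> Q" for x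
  proof -
    obtain b c d where x: "x = (- n, b, c, d)" using xQ by (auto simp: Q_def)
    have ord: "b \<le> c" "c \<le> d" "- n + b + c \<ge> d"
      and QD: "2 * (n\<^sup>2 + b\<^sup>2 + c\<^sup>2 + d\<^sup>2) - (b + c + d - n)\<^sup>2 = 4 * m"
      using xQ by (auto simp: Q_def x root_quadruple_def QD_def algebra_simps)
    \<comment> \<open>Parity of the coordinate sum makes \<open>B\<close>, half of
      \<open>a + b + c - d\<close>, an integer.\<close>
    have "even ((b + c + d - n)\<^sup>2)"
    proof -
      have "(b + c + d - n)\<^sup>2 = 2 * (n\<^sup>2 + b\<^sup>2 + c\<^sup>2 + d\<^sup>2 - 2 * m)" using QD by simp
      then show ?thesis by simp
    qed
    then have "even (- n + b + c - d)" by (simp; blast)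
    then obtain B where B: "- n + b + c - d = 2 * B" by (elim evenE)
    define A where "A = b - n"
    define C where "C = c - n"
    have bcd: "b = n + A" "c = n + C" "d = n + A + C - 2 * B"
      using B by (auto simp: A_def C_def)
    have eq: "A * C = B\<^sup>2 + (n\<^sup>2 - m)"
      using QD unfolding bcd by (simp add: power2_eq_square algebra_simps)
    have ineq: "A \<le> C" "0 \<le> B" "2 * B \<le> A" using ord bcd by auto
    \<comment> \<open>\<open>A = 0\<close> would force \<open>B = 0\<close> and hence
      \<open>m = n^2\<close>, against the bound on \<open>m\<close>.\<close>
    have "A \<noteq> 0" using eq ineq assms by auto
    then have "0 < A" using ineq by auto
    moreover have "f x = (A, B)" using B by (simp add: f_def x A_def)
    ultimately show ?thesis using x bcd eq ineq by blast
  qed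
  have "inj_on f Q"
  proof (rule inj_onI)
    fix x y assume xy: "x \<in> Q" "y \<in> Q" "f x = f y"
    obtain A B C where x: "x = (- n, n + A, n + C, n + A + C - 2 * B)" "f x = (A, B)"
      "A * C = B\<^sup>2 + (n\<^sup>2 - m)" "0 < A" using Q[OF xy(1)] by blast
    obtain A' B' C' where y: "y = (- n, n + A', n + C', n + A' + C' - 2 * B')" "f y = (A', B')"
      "A' * C' = B'\<^sup>2 + (n\<^sup>2 - m)" using Q[OF xy(2)] by blast
    have AB: "A' = A" "B' = B" using x(2) y(2) xy(3) by auto
    then have "A * C' = A * C" using x(3) y(3) by simp
    then have "C' = C" using x(4) by simp
    then show "x = y" using x(1) y(1) AB by simp
  qed
  moreover have "f ` Q \<subseteq> ?S"
  proof (rule image_subsetI)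
    fix x assume "x \<in> Q"
    from Q[OF this] obtain A B C where x: "f x = (A, B)" "A * C = B\<^sup>2 + (n\<^sup>2 - m)"
      "0 < A" "A \<le> C" "0 \<le> B" "2 * B \<le> A" by blast
    \<comment> \<open>\<open>A^2 \<le> A * C = B^2 + (n^2 - m)\<close> and
      \<open>B^2 \<le> A^2 / 4\<close> together bound \<open>A\<close>.\<close>
    have "A * A \<le> A * C" using x by (intro mult_left_mono) auto
    moreover have "(2 * B) * (2 * B) \<le> A * A" using x by (intro mult_mono) auto
    ultimately have "3 * (A * A) \<le> 4 * (n\<^sup>2 - m)" using x(2) by (simp add: power2_eq_square)
    also have "\<dots> < 8 * n\<^sup>2" using assms by simp
    also have "\<dots> \<le> 12 * n\<^sup>2" by simp
    finally have "A\<^sup>2 < (2 * n)\<^sup>2" by (simp add: power2_eq_square)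
    then have "A < 2 * n" by (rule power_less_imp_less_base) (use assms in simp)
    moreover have "A dvd B\<^sup>2 + (n\<^sup>2 - m)" by (metis dvd_triv_left x(2))
    ultimately show "f x \<in> ?S" using x by simp
  qed
  moreover have "finite ?S"
    by (rule finite_subset[of _ "{0..2 * n} \<times> {0..2 * n}"]) auto
  ultimately have "card Q \<le> card ?S" by (rule card_inj_on_le)
  then show ?thesis by (simp add: N_root_def Q_def)
qed

section \<open>The log log factor and the final estimate\<close>

text \<open>Here \<open>K\<close> is about the iterated binary logarithm of \<open>M\<close>, which
  is \<open>ln (ln n) / ln 2\<close> up to a bounded term. That term is absorbed into the factor
  \<open>c\<close> because \<open>ln (ln n)\<close> is at least \<open>l > 0\<close>.\<close>

lemma sum_inverse_divisors_loglog_bound: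
  obtains c :: real where
    "\<And>(n::nat) M. 3 \<le> n \<Longrightarrow> 0 < M \<Longrightarrow> M \<le> 8 * n\<^sup>2 \<Longrightarrow>
      (\<Sum>d | d dvd M. 1 / real d) \<le> c * (ln (ln (real n)))\<^sup>2"
proof -
  define l where "l = ln (ln (3::real))"
  \<comment> \<open>Strict positivity of \<open>l\<close> needs \<open>ln 3 > 1\<close>; this
    follows from \<open>(6 / 5) ^ 6 < 3\<close>.\<close>
  have "1 \<le> - 6 * ln (5 / 6 :: real)" using ln_le_minus_one[of "5 / 6 :: real"] by simp
  also have "\<dots> = ln ((6 / 5 :: real) ^ 6)" by (subst ln_realpow) (simp_all add: ln_div)
  also have "\<dots> < ln 3" by (simp add: power_divide)
  finally have "ln (3::real) > 1" .
  then have "l > 0" by (simp add: l_def)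
  \<comment> \<open>The additive constant in
    \<open>log 2 (7 * log 2 n) + 1 = ln (ln n) / ln 2 + e\<close>.\<close>
  define e :: real where "e = 1 + log 2 7 - ln (ln 2) / ln 2"
  have "ln (ln (2::real)) \<le> 0"
    using ln_le_minus_one[of "2::real"] by simp
  then have "ln (ln (2::real)) / ln 2 \<le> 0" by (simp add: divide_nonpos_pos)
  moreover have "log 2 (7::real) > 0" by simp
  ultimately have "e > 0" unfolding e_def by linarith
  define c where "c = 1 / ln 2 + e / l"
  show thesis
  proof (rule that[of "exp 4 * c\<^sup>2"])
    fix n M :: nat assume n: "3 \<le> n" and M: "0 < M" "M \<le> 8 * n\<^sup>2"
    have "ln (real n) \<ge> ln 3" using n by simp
    then have lln: "ln (ln (real n)) \<ge> l" using \<open>ln 3 > 1\<close> unfolding l_def by simp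
    \<comment> \<open>Adding 1 to the floors yields \<open>M < 2 ^ L\<close> and
      \<open>L \<le> 2 ^ K\<close>.\<close>
    define L where "L = nat \<lfloor>log 2 (real M)\<rfloor> + 1"
    define K where "K = nat \<lfloor>log 2 (real L)\<rfloor> + 1"
    have "log 2 (real M) \<ge> 0" using M by simp
    have "log 2 (real M) < real L" unfolding L_def by linarith
    then have "real M < real (2 ^ L)" using M by (simp add: log_less_iff powr_realpow)
    then have M_less: "M < 2 ^ L" by (simp only: of_nat_less_iff)
    have "log 2 (real L) < real K" unfolding K_def by linarith
    then have "real L < real (2 ^ K)" by (simp add: log_less_iff powr_realpow L_def)
    then have LK: "L \<le> 2 ^ K" by linarith
    have "real L \<le> log 2 (real M) + 1" using \<open>log 2 (real M) \<ge> 0\<close> unfolding L_def by simp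
    also have "log 2 (real M) \<le> log 2 (8 * real n ^ 2)"
    proof -
      have "real M \<le> real (8 * n\<^sup>2)" using M by (simp only: of_nat_le_iff)
      then show ?thesis using M n by simp
    qed
    also have "log 2 (8 * real n ^ 2) + 1 = 4 + 2 * log 2 (real n)"
      using n log_pow_cancel[of "2::real" 3] by (simp add: log_mult log_nat_power)
    also have "\<dots> \<le> 7 * log 2 (real n)"
    proof -
      have "1 \<le> log 2 (real n)" using n by (simp add: le_log_iff)
      then show ?thesis by simp
    qed
    finally have L: "real L \<le> 7 * (ln (real n) / ln 2)" by (simp add: log_def)
    have "real K \<le> log 2 (real L) + 1" unfolding K_def by (simp add: L_def)
    also have "\<dots> \<le> log 2 (7 * (ln (real n) / ln 2)) + 1"
      using L by (intro add_mono log_mono) (auto simp: L_def)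
    also have "\<dots> = ln (ln (real n)) / ln 2 + e"
    proof -
      have "ln (7 * (ln (real n) / ln 2)) = ln 7 + (ln (ln (real n)) - ln (ln 2))"
        using n by (simp add: ln_mult ln_div)
      then show ?thesis by (simp add: log_def e_def add_divide_distrib diff_divide_distrib)
    qed
    also have "\<dots> \<le> ln (ln (real n)) / ln 2 + e / l * ln (ln (real n))"
      using \<open>e > 0\<close> \<open>l > 0\<close> lln by (simp add: field_simps)
    also have "\<dots> = c * ln (ln (real n))" by (simp add: c_def algebra_simps)
    finally have Kc: "real K \<le> c * ln (ln (real n))" .
    have "(\<Sum>d | d dvd M. 1 / real d) \<le> exp 4 * real K ^ 2"
      using M M_less LK by (intro sum_inverse_divisors_le) (auto simp: K_def)
    also have "\<dots> \<le> exp 4 * (c * ln (ln (real n))) ^ 2"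
      using Kc by (intro mult_left_mono power_mono) auto
    also have "\<dots> = exp 4 * c\<^sup>2 * (ln (ln (real n)))\<^sup>2"
      by (simp add: power_mult_distrib)
    finally show "(\<Sum>d | d dvd M. 1 / real d) \<le> exp 4 * c\<^sup>2 * (ln (ln (real n)))\<^sup>2" .
  qed
qed

theorem theorem4p2:
  shows "\<exists>C::real. \<forall>m n :: int. n \<ge> 3 \<and> real_of_int n > sqrt (real_of_int \<bar>m\<bar>) \<longrightarrow>
           real (N_root m n) \<le> C * real_of_int n * ln (real_of_int n) * (ln (ln (real_of_int n)))^2"
proof -
  obtain c :: real where c:
    "\<And>(n::nat) M. 3 \<le> n \<Longrightarrow> 0 < M \<Longrightarrow> M \<le> 8 * n\<^sup>2 \<Longrightarrow>
      (\<Sum>d | d dvd M. 1 / real d) \<le> c * (ln (ln (real n)))\<^sup>2"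
    using sum_inverse_divisors_loglog_bound by blast
  \<comment> \<open>The 6 is 2 from the range \<open>A \<le> 2 * n\<close> times 3 from
    \<open>1 + ln (2 * n) \<le> 3 * ln n\<close>, which uses \<open>ln n \<ge> 1\<close>.\<close>
  have "real (N_root m n) \<le> (6 * c) * real_of_int n * ln (real_of_int n) * (ln (ln (real_of_int n)))^2"
    if n: "n \<ge> 3" and mn: "real_of_int n > sqrt (real_of_int \<bar>m\<bar>)" for m n :: int
  proof -
    define N where "N = nat n"
    have nN: "n = int N" and "N \<ge> 3" using n by (auto simp: N_def)
    have "(sqrt (real_of_int \<bar>m\<bar>))\<^sup>2 < (real_of_int n)\<^sup>2"
      using mn by (intro power_strict_mono) auto
    then have "real_of_int \<bar>m\<bar> < (real_of_int n)\<^sup>2" by simp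
    then have m: "\<bar>m\<bar> < n\<^sup>2" by (metis of_int_less_iff of_int_power)
    define D where "D = n\<^sup>2 - m"
    have D: "0 < D" "D < 2 * n\<^sup>2" using m by (auto simp: D_def)
    have ln: "1 \<le> ln (real N)" using \<open>N \<ge> 3\<close> exp_le
      by (subst ln_ge_iff) auto
    have "real (N_root m n)
        \<le> real (card {(A, B). 0 < A \<and> A \<le> int (2 * N) \<and> 0 \<le> B \<and> B < A \<and> A dvd B\<^sup>2 + D})"
      using N_root_le_card_sqrt_residues[of n m] m n by (simp add: D_def nN)
    also have "\<dots> \<le> real (2 * N) * (\<Sum>u=1..2 * N. 1 / real u) * (\<Sum>h | h dvd nat (4 * D). 1 / real h)"
      by (rule card_sqrt_residues_le[OF D(1)])
    also have "\<dots> \<le> real (2 * N) * (3 * ln (real N)) * (c * (ln (ln (real N)))\<^sup>2)"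
    proof (intro mult_mono)
      have "(\<Sum>u=1..2 * N. 1 / real u) \<le> 1 + ln (real (2 * N))"
        using \<open>N \<ge> 3\<close> by (intro harmonic_sum_le) auto
      also have "ln (real (2 * N)) = ln 2 + ln (real N)" using \<open>N \<ge> 3\<close> by (simp add: ln_mult)
      also have "ln (2::real) \<le> 1" using ln_le_minus_one[of "2::real"] by simp
      finally show "(\<Sum>u=1..2 * N. 1 / real u) \<le> 3 * ln (real N)" using ln by simp
      \<comment> \<open>\<open>D < 2 * n^2\<close> puts \<open>4 * D\<close> in the range where the
        divisor bound applies.\<close>
      have "4 * D \<le> int (8 * N\<^sup>2)" using D by (simp add: nN)
      then have "nat (4 * D) \<le> 8 * N\<^sup>2" by linarith
      then show "(\<Sum>h | h dvd nat (4 * D). 1 / real h) \<le> c * (ln (ln (real N)))\<^sup>2"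
        using D \<open>N \<ge> 3\<close> by (intro c) auto
    qed (use ln in \<open>auto intro!: sum_nonneg\<close>)
    finally show ?thesis by (simp add: nN mult_ac)
  qed
  then show ?thesis by blast
qed

end
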